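(* Let $X$ be a locale whose frame is given by a $\mathbf{DCPO}$-type presentation $\mathcal{O}X = \langle G \text{ dist. lattice} \mid R\rangle_{\mathbf{Frm}}$, and let $q\colon X \twoheadrightarrow Y$ be a semi-triquotient with Scott-continuous retraction $q_\#\colon\mathcal{O}X\to\mathcal{O}Y$ of $q^*$. Then $$\mathcal{O}Y \cong \langle \boxtimes g,\ g \in G \mid R,\ \boxtimes 1 = 1,\ \boxtimes 0 = 0,\ \boxtimes s \wedge \boxtimes t = \boxtimes(q^*q_\#(s) \wedge q^*q_\#(t)),\ \boxtimes s \vee \boxtimes t = \boxtimes(q^*q_\#(s) \vee q^*q_\#(t)),\ s,t \in G\rangle_{\mathbf{Frm}},$$ where the generators $\boxtimes g$ are indexed by the underlying set of $G$; for specified representations $q^*q_\#(s) = \bigvee^{\uparrow}_{\alpha} s_\alpha$ and $q^*q_\#(t) = \bigvee^{\uparrow}_{\beta} t_\beta$ in $\mathcal{O}X$ as directed joins of generators from $G$, $\boxtimes(q^*q_\#(s)\wedge q^*q_\#(t))$ is interpreted as $\bigvee^{\uparrow}_{\alpha,\beta} \boxtimes(s_\alpha \wedge t_\beta)$ and $\boxtimes(q^*q_\#(s)\vee q^*q_\#(t))$ as $\bigvee^{\uparrow}_{\alpha,\beta} \boxtimes(s_\alpha \vee t_\beta)$ (with $s_\alpha\wedge t_\beta$ and $s_\alpha\vee t_\beta$ computed in $G$); and each relation of $R$ is read with every generator $g$ replaced by $\boxtimes g$.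
   Context: For a locale $X$, $\mathcal{O}X$ denotes its frame; a locale map $f\colon X\to Y$ corresponds to a frame homomorphism $f^*\colon\mathcal{O}Y\to\mathcal{O}X$. A semi-triquotient is a locale map $q\colon X\to Y$ such that $q^*$ has a Scott-continuous (directed-join-preserving) retraction $q_\#\colon\mathcal{O}X\to\mathcal{O}Y$, i.e. $q_\# q^* = \mathrm{id}$ (no further conditions). $\bigvee^{\uparrow}$ denotes a join of a directed family. $\langle G\mid R\rangle_{\mathbf{Frm}}$ denotes the frame presented by generators $G$ and relations $R$ (formal equalities and inequalities between elements of the free frame on $G$); "$G$ dist. lattice" means the free frame on the bounded distributive lattice $G$ is used (equivalently, relations are added forcing finite meets and joins, including $1$ and $0$, to agree with those in $G$). A presentation $\langle G \text{ dist. lattice}\mid R\rangle_{\mathbf{Frm}}$, $G$ a bounded distributive lattice, is $\mathbf{DCPO}$-type if every relation in $R$ has the form $\bigvee^{\uparrow} A \le \bigvee^{\uparrow} B$ with $A,B\subseteq G$ directed, and whenever this is in $R$, so are $\bigvee^{\uparrow}_{a\in A}(a\wedge c) \le \bigvee^{\uparrow}_{b\in B}(b\wedge c)$ and $\bigvee^{\uparrow}_{a\in A}(a\vee c) \le \bigvee^{\uparrow}_{b\in B}(b\vee c)$ for each $c\in G$.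
   Formalization: The meet and join relations for ⊠ are imposed for all representations of q*q_#(s) and q*q_#(t) as directed joins of generators, not for one specified choice each; with an arbitrary specified choice ⊠ need not be monotone and the claim can fail. *)

theory Defs
  imports Main "HOL-Library.FSet"
begin

(* Joins distribute over binary meets only: the library class complete_distrib_lattice asks for
   complete distributivity, which fails for a general frame. *)
class frame = complete_lattice +
  assumes inf_Sup_frame: "inf a (Sup B) = (SUP b\<in>B. inf a b)"

definition frame_hom :: "('a::frame \<Rightarrow> 'b::frame) \<Rightarrow> bool" where
  "frame_hom f \<longleftrightarrow>
     f top = top \<and> (\<forall>a b. f (inf a b) = inf (f a) (f b)) \<and> (\<forall>A. f (Sup A) = Sup (f ` A))"

definition directed :: "'a::order set \<Rightarrow> bool" where
  "directed A \<longleftrightarrow> A \<noteq> {} \<and> (\<forall>a\<in>A. \<forall>b\<in>A. \<exists>c\<in>A. a \<le> c \<and> b \<le> c)"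

definition scott_continuous :: "('a::complete_lattice \<Rightarrow> 'b::complete_lattice) \<Rightarrow> bool" where
  "scott_continuous f \<longleftrightarrow> (\<forall>A. directed A \<longrightarrow> f (Sup A) = Sup (f ` A))"

(* For a locale map q : X -> Y, the arguments are q^* : OY -> OX and q_# : OX -> OY. *)
definition semi_triquotient :: "('y::frame \<Rightarrow> 'x::frame) \<Rightarrow> ('x \<Rightarrow> 'y) \<Rightarrow> bool" where
  "semi_triquotient qstar qsharp \<longleftrightarrow>
     frame_hom qstar \<and> scott_continuous qsharp \<and> qsharp \<circ> qstar = id"


text \<open>
  The free frame on a set of generators: finite sets of generators, ordered by reverse inclusion,
  form the free meet-semilattice (a finite set stands for the meet of its elements), and the free
  frame consists of the down-sets of that order, i.e. the inclusion-upward closed families.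
\<close>

typedef 'g free_frame = "{U :: 'g fset set. \<forall>S\<in>U. \<forall>T. S |\<subseteq>| T \<longrightarrow> T \<in> U}"
  by (rule exI[of _ UNIV]) simp

setup_lifting type_definition_free_frame

instantiation free_frame :: (type) frame
begin

lift_definition less_eq_free_frame :: "'a free_frame \<Rightarrow> 'a free_frame \<Rightarrow> bool" is "(\<subseteq>)" .
lift_definition less_free_frame :: "'a free_frame \<Rightarrow> 'a free_frame \<Rightarrow> bool" is "(\<subset>)" .
lift_definition inf_free_frame :: "'a free_frame \<Rightarrow> 'a free_frame \<Rightarrow> 'a free_frame" is "(\<inter>)"
  by blast
lift_definition sup_free_frame :: "'a free_frame \<Rightarrow> 'a free_frame \<Rightarrow> 'a free_frame" is "(\<union>)"
  by blast
lift_definition Inf_free_frame :: "'a free_frame set \<Rightarrow> 'a free_frame" is Inter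
  by blast
lift_definition Sup_free_frame :: "'a free_frame set \<Rightarrow> 'a free_frame" is Union
  by blast
lift_definition bot_free_frame :: "'a free_frame" is "{}"
  by blast
lift_definition top_free_frame :: "'a free_frame" is UNIV
  by blast

instance
proof
  fix x y z :: "'a free_frame" and A :: "'a free_frame set"
  note rep_eqs = less_eq_free_frame.rep_eq less_free_frame.rep_eq inf_free_frame.rep_eq
    sup_free_frame.rep_eq Inf_free_frame.rep_eq Sup_free_frame.rep_eq
    bot_free_frame.rep_eq top_free_frame.rep_eq
  show "(x < y) = (x \<le> y \<and> \<not> y \<le> x)" by (auto simp: rep_eqs)
  show "x \<le> x" by (simp add: rep_eqs)
  show "x \<le> y \<Longrightarrow> y \<le> z \<Longrightarrow> x \<le> z" by (simp add: rep_eqs)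
  show "x \<le> y \<Longrightarrow> y \<le> x \<Longrightarrow> x = y" by (simp add: rep_eqs flip: Rep_free_frame_inject)
  show "inf x y \<le> x" by (simp add: rep_eqs)
  show "inf x y \<le> y" by (simp add: rep_eqs)
  show "x \<le> y \<Longrightarrow> x \<le> z \<Longrightarrow> x \<le> inf y z" by (simp add: rep_eqs)
  show "x \<le> sup x y" by (simp add: rep_eqs)
  show "y \<le> sup x y" by (simp add: rep_eqs)
  show "y \<le> x \<Longrightarrow> z \<le> x \<Longrightarrow> sup y z \<le> x" by (simp add: rep_eqs)
  show "x \<in> A \<Longrightarrow> Inf A \<le> x" by (auto simp: rep_eqs)
  show "(\<And>x. x \<in> A \<Longrightarrow> z \<le> x) \<Longrightarrow> z \<le> Inf A" by (auto simp: rep_eqs)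
  show "x \<in> A \<Longrightarrow> x \<le> Sup A" by (auto simp: rep_eqs)
  show "(\<And>x. x \<in> A \<Longrightarrow> x \<le> z) \<Longrightarrow> Sup A \<le> z" by (auto simp: rep_eqs)
  show "Inf {} = (top :: 'a free_frame)" by (simp add: rep_eqs flip: Rep_free_frame_inject)
  show "Sup {} = (bot :: 'a free_frame)" by (simp add: rep_eqs flip: Rep_free_frame_inject)
  show "inf x (Sup A) = (SUP b\<in>A. inf x b)"
    by (auto simp: rep_eqs simp flip: Rep_free_frame_inject)
qed

end

lift_definition gen :: "'g \<Rightarrow> 'g free_frame" is "\<lambda>g. {S. g |\<in>| S}"
  by blast

lemma frame_hom_finite_meet:
  assumes "frame_hom h"
  shows "finite F \<Longrightarrow> h (Inf (f ` F)) = (INF x\<in>F. h (f x))"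
  by (induction F rule: finite_induct) (use assms in \<open>simp_all add: frame_hom_def\<close>)

lemma free_frame_normal_form:
  "u = (SUP S\<in>Rep_free_frame u. INF g\<in>fset S. gen g)"
proof -
  have meet: "Rep_free_frame (INF g\<in>fset S. gen g) = {T. S |\<subseteq>| T}" for S :: "'a fset"
    by (auto simp: Inf_free_frame.rep_eq gen.rep_eq)
  have "Rep_free_frame u
      = Rep_free_frame (SUP S\<in>Rep_free_frame u. INF g\<in>fset S. gen g)"
    using Rep_free_frame[of u]
    by (simp add: Sup_free_frame.rep_eq image_image meet) blast
  then show ?thesis
    by (simp add: Rep_free_frame_inject)
qed

lemma free_frame_universal:
  fixes f :: "'g \<Rightarrow> 'm::frame"
  shows "\<exists>!h. frame_hom h \<and> (\<forall>g. h (gen g) = f g)"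
proof (rule ex_ex1I)
  define m where "m S = (INF g\<in>fset S. f g)" for S
  define h where "h u = (SUP S\<in>Rep_free_frame u. m S)" for u
  have m_inf: "inf (m S) (m T) = m (S |\<union>| T)" for S T
    by (simp add: m_def INF_union)
  have h_inf: "h (inf u v) = inf (h u) (h v)" for u v
  proof (rule antisym)
    show "h (inf u v) \<le> inf (h u) (h v)"
      by (auto simp: h_def inf_free_frame.rep_eq intro!: SUP_subset_mono)
    have "inf (h u) (h v) = (SUP T\<in>Rep_free_frame v. inf (h u) (m T))"
      unfolding h_def by (subst inf_Sup_frame) (simp add: image_image)
    also have "\<dots> = (SUP T\<in>Rep_free_frame v. SUP S\<in>Rep_free_frame u. inf (m T) (m S))"
    proof (rule SUP_cong[OF refl])
      fix T
      show "inf (h u) (m T) = (SUP S\<in>Rep_free_frame u. inf (m T) (m S))"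
        unfolding h_def by (subst inf_commute, subst inf_Sup_frame) (simp add: image_image)
    qed
    also have "\<dots> \<le> h (inf u v)"
    proof (intro SUP_least)
      fix S T assume "T \<in> Rep_free_frame v" "S \<in> Rep_free_frame u"
      then have "T |\<union>| S \<in> Rep_free_frame (inf u v)"
        using Rep_free_frame[of u] Rep_free_frame[of v]
        by (simp add: inf_free_frame.rep_eq)
      then show "inf (m T) (m S) \<le> h (inf u v)"
        unfolding m_inf h_def by (rule SUP_upper)
    qed
    finally show "inf (h u) (h v) \<le> h (inf u v)" .
  qed
  have h_top: "h top = top"
  proof -
    have "m {||} \<le> h top"
      unfolding h_def by (rule SUP_upper) (simp add: top_free_frame.rep_eq)
    then show ?thesis
      by (simp add: m_def top_unique)
  qed
  have h_Sup: "h (Sup A) = Sup (h ` A)" for A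
    by (simp add: h_def Sup_free_frame.rep_eq SUP_UNION)
  have h_gen: "h (gen g) = f g" for g
  proof (rule antisym)
    show "h (gen g) \<le> f g"
      unfolding h_def m_def gen.rep_eq
      by (rule SUP_least) (auto intro: INF_lower)
    have "m {|g|} \<le> h (gen g)"
      unfolding h_def by (rule SUP_upper) (simp add: gen.rep_eq)
    then show "f g \<le> h (gen g)"
      by (simp add: m_def)
  qed
  show "\<exists>h. frame_hom h \<and> (\<forall>g. h (gen g) = f g)"
    using h_top h_inf h_Sup h_gen unfolding frame_hom_def by blast
next
  fix h h' :: "'g free_frame \<Rightarrow> 'm"
  assume h: "frame_hom h \<and> (\<forall>g. h (gen g) = f g)"
    and h': "frame_hom h' \<and> (\<forall>g. h' (gen g) = f g)"
  have normal: "k u = (SUP S\<in>Rep_free_frame u. INF g\<in>fset S. f g)"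
    if k: "frame_hom k" "\<forall>g. k (gen g) = f g" for k :: "'g free_frame \<Rightarrow> 'm" and u
  proof -
    have "k u = k (SUP S\<in>Rep_free_frame u. INF g\<in>fset S. gen g)"
      using free_frame_normal_form[of u] by simp
    also have "\<dots> = (SUP S\<in>Rep_free_frame u. k (INF g\<in>fset S. gen g))"
      using k(1) by (simp add: frame_hom_def image_image)
    finally show ?thesis
      using k by (simp add: frame_hom_finite_meet)
  qed
  show "h = h'"
    using normal h h' by (intro ext) metis
qed


text \<open>
  Frame presentations. A set \<open>E\<close> of pairs of elements of the free frame is read as the set of
  relations \<open>u = v\<close> for \<open>(u, v) \<in> E\<close>; the presented frame is the quotient of the free frame by
  the frame congruence that \<open>E\<close> generates.
\<close>

definition frame_congruence :: "('a::frame \<times> 'a) set \<Rightarrow> bool" where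
  "frame_congruence \<theta> \<longleftrightarrow> equiv UNIV \<theta>
     \<and> (\<forall>a b c d. (a, b) \<in> \<theta> \<and> (c, d) \<in> \<theta> \<longrightarrow> (inf a c, inf b d) \<in> \<theta>)
     \<and> (\<forall>P. P \<subseteq> \<theta> \<longrightarrow> (Sup (fst ` P), Sup (snd ` P)) \<in> \<theta>)"

definition generated_congruence :: "('a::frame \<times> 'a) set \<Rightarrow> ('a \<times> 'a) set" where
  "generated_congruence E = \<Inter>{\<theta>. frame_congruence \<theta> \<and> E \<subseteq> \<theta>}"

lemma frame_congruence_generated: "frame_congruence (generated_congruence E)"
proof -
  let ?C = "{\<theta>. frame_congruence \<theta> \<and> E \<subseteq> \<theta>}"
  have eq: "equiv UNIV \<theta>" if "\<theta> \<in> ?C" for \<theta>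
    using that by (simp add: frame_congruence_def)
  have "equiv UNIV (\<Inter>?C)"
  proof (rule equivI)
    show "refl_on UNIV (\<Inter>?C)"
      using eq by (auto simp: equiv_def refl_on_def)
    show "sym (\<Inter>?C)"
      using eq by (intro symI InterI) (meson InterD equivE symD)
    show "trans (\<Inter>?C)"
      using eq by (intro transI InterI) (meson InterD equivE transD)
  qed simp
  moreover have "(inf a c, inf b d) \<in> \<Inter>?C" if "(a, b) \<in> \<Inter>?C" "(c, d) \<in> \<Inter>?C" for a b c d
  proof (rule InterI)
    fix \<theta> assume \<theta>: "\<theta> \<in> ?C"
    with that have "(a, b) \<in> \<theta>" "(c, d) \<in> \<theta>"
      by blast+
    with \<theta> show "(inf a c, inf b d) \<in> \<theta>"
      by (simp add: frame_congruence_def)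
  qed
  moreover have "(Sup (fst ` P), Sup (snd ` P)) \<in> \<Inter>?C" if "P \<subseteq> \<Inter>?C" for P
  proof (rule InterI)
    fix \<theta> assume \<theta>: "\<theta> \<in> ?C"
    with that have "P \<subseteq> \<theta>"
      by blast
    with \<theta> show "(Sup (fst ` P), Sup (snd ` P)) \<in> \<theta>"
      by (simp add: frame_congruence_def)
  qed
  ultimately show ?thesis
    unfolding generated_congruence_def frame_congruence_def[of "\<Inter>?C"] by blast
qed

(* The frame operations on the quotient are those making the projection a frame homomorphism, so
   a bijection phi out of the quotient is a frame isomorphism iff its composite with the
   projection is a frame homomorphism. *)
definition presentation_iso ::
    "('g free_frame \<times> 'g free_frame) set \<Rightarrow> ('g free_frame set \<Rightarrow> 'a::frame) \<Rightarrow> bool" where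
  "presentation_iso E \<phi> \<longleftrightarrow> bij_betw \<phi> (UNIV // generated_congruence E) UNIV
     \<and> frame_hom (\<lambda>u. \<phi> (generated_congruence E `` {u}))"

definition leq_relation :: "'a::lattice \<Rightarrow> 'a \<Rightarrow> 'a \<times> 'a" where
  "leq_relation u v = (inf u v, u)"

definition lattice_relations ::
    "('g::{distrib_lattice,bounded_lattice} free_frame \<times> 'g free_frame) set" where
  "lattice_relations =
     {(gen top, top), (gen bot, bot)}
     \<union> {(gen (inf s t), inf (gen s) (gen t)) |s t. True}
     \<union> {(gen (sup s t), sup (gen s) (gen t)) |s t. True}"

(* A pair (A, B) in R is the formal relation "join of A \<le> join of B". *)
definition join_relations :: "('g set \<times> 'g set) set \<Rightarrow> ('g free_frame \<times> 'g free_frame) set" where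
  "join_relations R = {leq_relation (SUP a\<in>A. gen a) (SUP b\<in>B. gen b) |A B. (A, B) \<in> R}"

definition DCPO_type :: "('g::{distrib_lattice,bounded_lattice} set \<times> 'g set) set \<Rightarrow> bool" where
  "DCPO_type R \<longleftrightarrow> (\<forall>(A, B)\<in>R. directed A \<and> directed B
     \<and> (\<forall>c. ((\<lambda>a. inf a c) ` A, (\<lambda>b. inf b c) ` B) \<in> R
          \<and> ((\<lambda>a. sup a c) ` A, (\<lambda>b. sup b c) ` B) \<in> R))"

definition generator_image ::
    "('g::{distrib_lattice,bounded_lattice} set \<times> 'g set) set \<Rightarrow> ('g free_frame set \<Rightarrow> 'x::frame)
       \<Rightarrow> 'g \<Rightarrow> 'x" where
  "generator_image R \<iota> g =
     \<iota> (generated_congruence (lattice_relations \<union> join_relations R) `` {gen g})"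

definition represents :: "('g::order \<Rightarrow> 'x::complete_lattice) \<Rightarrow> 'x \<Rightarrow> 'g set \<Rightarrow> bool" where
  "represents \<gamma> x S \<longleftrightarrow> directed S \<and> x = (SUP g\<in>S. \<gamma> g)"

text \<open>
  Relations for the generators \<open>\<boxtimes>g = gen g\<close>, where \<open>\<gamma>\<close> maps the elements of the lattice to the
  frame of \<open>X\<close> and \<open>k\<close> is the composite of \<open>q\<^sub>#\<close> followed by \<open>q\<^sup>*\<close>. The interpretation of
  \<open>\<boxtimes>(k s \<and> k t)\<close> and \<open>\<boxtimes>(k s \<or> k t)\<close> is imposed for every pair of representations of \<open>k s\<close>
  and \<open>k t\<close> as directed joins of generators. Since \<open>s \<le> t\<close> in the lattice is not itself a relation
  between \<open>\<boxtimes>s\<close> and \<open>\<boxtimes>t\<close>, a single arbitrary choice of representations would not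
  force \<open>\<boxtimes>\<close> to be monotone and would in general present a different frame.
\<close>

definition box_relations ::
    "('g::{distrib_lattice,bounded_lattice} \<Rightarrow> 'x::frame) \<Rightarrow> ('x \<Rightarrow> 'x)
       \<Rightarrow> ('g free_frame \<times> 'g free_frame) set" where
  "box_relations \<gamma> k =
     {(gen top, top), (gen bot, bot)}
     \<union> {(inf (gen s) (gen t), SUP a\<in>S. SUP b\<in>T. gen (inf a b)) |s t S T.
          represents \<gamma> (k (\<gamma> s)) S \<and> represents \<gamma> (k (\<gamma> t)) T}
     \<union> {(sup (gen s) (gen t), SUP a\<in>S. SUP b\<in>T. gen (sup a b)) |s t S T.
          represents \<gamma> (k (\<gamma> s)) S \<and> represents \<gamma> (k (\<gamma> t)) T}"

end

theory Submission
  imports Defs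
begin

text \<open>
  The isomorphism sends \<open>\<boxtimes>g\<close> to \<open>q\<^sub># g\<close>. Its inverse sends \<open>y\<close> to the join of all \<open>\<boxtimes>g\<close> with
  \<open>g \<le> q\<^sup>* y\<close>. That this inverse preserves directed joins rests on a coverage theorem: for a
  DCPO-type presentation, \<open>g \<le> \<Squnion> S\<close> with \<open>S\<close> directed holds in the presented frame only if \<open>g\<close>
  lies in the least down-set that contains \<open>S\<close> and is closed under the relations. The meet and
  join relations for \<open>\<boxtimes>\<close> then give finite meets and joins, using \<open>q\<^sup>* y = \<Squnion> {k s | s \<le> q\<^sup>* y}\<close>,
  where \<open>k\<close> is \<open>q\<^sub>#\<close> followed by \<open>q\<^sup>*\<close>.
\<close>

section \<open>Frame homomorphisms and Scott-continuous maps\<close>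

lemma frame_hom_top: "frame_hom f \<Longrightarrow> f top = top"
  by (simp add: frame_hom_def)

lemma frame_hom_inf: "frame_hom f \<Longrightarrow> f (inf a b) = inf (f a) (f b)"
  by (simp add: frame_hom_def)

lemma frame_hom_Sup: "frame_hom f \<Longrightarrow> f (Sup A) = Sup (f ` A)"
  by (simp add: frame_hom_def)

lemma frame_hom_bot: "frame_hom f \<Longrightarrow> f bot = bot"
  using frame_hom_Sup[of f "{}"] by simp

lemma frame_hom_sup: "frame_hom f \<Longrightarrow> f (sup a b) = sup (f a) (f b)"
  using frame_hom_Sup[of f "{a, b}"] by simp

lemma frame_hom_mono: "frame_hom f \<Longrightarrow> a \<le> b \<Longrightarrow> f a \<le> f b"
  by (metis frame_hom_inf inf.absorb_iff2 inf_commute)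

lemma scott_continuousD: "scott_continuous f \<Longrightarrow> directed A \<Longrightarrow> f (Sup A) = Sup (f ` A)"
  by (simp add: scott_continuous_def)

lemma scott_continuous_mono:
  assumes "scott_continuous f" "a \<le> b"
  shows "f a \<le> f b"
proof -
  have "directed {a, b}"
    using assms(2) by (auto simp: directed_def)
  from scott_continuousD[OF assms(1) this] have "f b = sup (f a) (f b)"
    using assms(2) by (simp add: sup.absorb2)
  then show ?thesis
    by (metis sup_ge1)
qed

lemma directed_image:
  assumes "directed A" and mono: "\<And>a b. a \<le> b \<Longrightarrow> f a \<le> f b"
  shows "directed (f ` A)"
  using assms(1) unfolding directed_def by (auto 4 3 intro: mono)

lemma directed_image2:
  assumes "directed S" "directed T"
    and mono: "\<And>a b c d. a \<le> c \<Longrightarrow> b \<le> d \<Longrightarrow> f a b \<le> f c d"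
  shows "directed (case_prod f ` (S \<times> T))"
  unfolding directed_def
proof (intro conjI ballI)
  show "case_prod f ` (S \<times> T) \<noteq> {}"
    using assms by (auto simp: directed_def)
  fix x y assume "x \<in> case_prod f ` (S \<times> T)" "y \<in> case_prod f ` (S \<times> T)"
  then obtain a b c d where *: "x = f a b" "y = f c d" "a \<in> S" "c \<in> S" "b \<in> T" "d \<in> T"
    by auto
  then obtain s t where "s \<in> S" "a \<le> s" "c \<le> s" "t \<in> T" "b \<le> t" "d \<le> t"
    using assms(1,2) unfolding directed_def by metis
  then show "\<exists>z\<in>case_prod f ` (S \<times> T). x \<le> z \<and> y \<le> z"
    using * mono by (intro bexI[of _ "f s t"]) auto
qed

lemma SUP_prod: "(SUP p\<in>S \<times> T. f (fst p) (snd p)) = (SUP a\<in>S. SUP b\<in>T. f a b :: 'c::complete_lattice)"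
  by (intro antisym SUP_least) (force intro: SUP_upper2 SUP_upper)+

lemma inf_SUP_frame: "inf (a::'a::frame) (SUP x\<in>A. f x) = (SUP x\<in>A. inf a (f x))"
  by (simp add: inf_Sup_frame image_image)

lemma SUP_inf_SUP_frame:
  fixes f :: "'i \<Rightarrow> 'a::frame"
  shows "inf (SUP x\<in>A. f x) (SUP y\<in>B. g y) = (SUP x\<in>A. SUP y\<in>B. inf (f x) (g y))"
proof -
  have "inf (SUP x\<in>A. f x) (SUP y\<in>B. g y) = (SUP x\<in>A. inf (SUP y\<in>B. g y) (f x))"
    by (subst inf_commute) (rule inf_SUP_frame)
  then show ?thesis
    by (simp add: inf_commute[of "Sup _"] inf_SUP_frame)
qed

section \<open>Frame congruences\<close>

lemma frame_congruence_equiv: "frame_congruence \<theta> \<Longrightarrow> equiv UNIV \<theta>"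
  by (simp add: frame_congruence_def)

lemma frame_congruence_refl: "frame_congruence \<theta> \<Longrightarrow> (a, a) \<in> \<theta>"
  by (auto simp: frame_congruence_def equiv_def refl_on_def)

lemma frame_congruence_sym: "frame_congruence \<theta> \<Longrightarrow> (a, b) \<in> \<theta> \<Longrightarrow> (b, a) \<in> \<theta>"
  by (meson frame_congruence_equiv equivE symD)

lemma frame_congruence_trans:
  "frame_congruence \<theta> \<Longrightarrow> (a, b) \<in> \<theta> \<Longrightarrow> (b, c) \<in> \<theta> \<Longrightarrow> (a, c) \<in> \<theta>"
  by (meson frame_congruence_equiv equivE transD)

lemma frame_congruence_inf:
  "frame_congruence \<theta> \<Longrightarrow> (a, b) \<in> \<theta> \<Longrightarrow> (c, d) \<in> \<theta> \<Longrightarrow> (inf a c, inf b d) \<in> \<theta>"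
  by (simp add: frame_congruence_def)

lemma frame_congruence_SUP:
  assumes "frame_congruence \<theta>" "\<And>x. x \<in> A \<Longrightarrow> (f x, g x) \<in> \<theta>"
  shows "(SUP x\<in>A. f x, SUP x\<in>A. g x) \<in> \<theta>"
proof -
  have "(\<lambda>x. (f x, g x)) ` A \<subseteq> \<theta>"
    using assms(2) by auto
  with assms(1) have "(Sup (fst ` (\<lambda>x. (f x, g x)) ` A), Sup (snd ` (\<lambda>x. (f x, g x)) ` A)) \<in> \<theta>"
    unfolding frame_congruence_def by blast
  then show ?thesis
    by (simp add: image_image)
qed

lemma generated_congruence_base: "E \<subseteq> generated_congruence E"
  by (auto simp: generated_congruence_def)

lemma generated_congruence_least:
  "frame_congruence \<theta> \<Longrightarrow> E \<subseteq> \<theta> \<Longrightarrow> generated_congruence E \<subseteq> \<theta>"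
  by (auto simp: generated_congruence_def)

lemma frame_congruence_kernel:
  assumes "frame_hom h"
  shows "frame_congruence {(u, v). h u = h v}"
  unfolding frame_congruence_def
proof (intro conjI allI impI)
  show "equiv UNIV {(u, v). h u = h v}"
    by (auto simp: equiv_def refl_on_def sym_def trans_def)
next
  fix P assume P: "P \<subseteq> {(u, v). h u = h v}"
  then have "h ` fst ` P = h ` snd ` P"
    unfolding image_image by (intro image_cong) auto
  then show "(Sup (fst ` P), Sup (snd ` P)) \<in> {(u, v). h u = h v}"
    using assms by (simp add: frame_hom_Sup)
qed (use assms in \<open>auto simp: frame_hom_inf\<close>)

text \<open>This is the order of the quotient by \<theta>, kept on representatives so that chains of
  inequalities never pass to equivalence classes.\<close>

definition le_mod :: "('a::frame \<times> 'a) set \<Rightarrow> 'a \<Rightarrow> 'a \<Rightarrow> bool" where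
  "le_mod \<theta> u v \<longleftrightarrow> leq_relation u v \<in> \<theta>"

context
  fixes \<theta> :: "('a::frame \<times> 'a) set"
  assumes cong: "frame_congruence \<theta>"
begin

lemma le_mod_le: "u \<le> v \<Longrightarrow> le_mod \<theta> u v"
  by (simp add: le_mod_def leq_relation_def inf.absorb1 frame_congruence_refl[OF cong])

lemma le_mod_trans:
  assumes uv: "le_mod \<theta> u v" and vw: "le_mod \<theta> v w"
  shows "le_mod \<theta> u w"
proof -
  have uv: "(inf u v, u) \<in> \<theta>" and vw: "(inf v w, v) \<in> \<theta>"
    using uv vw by (simp_all add: le_mod_def leq_relation_def)
  have "(inf u w, inf (inf u v) w) \<in> \<theta>"
    by (intro frame_congruence_inf[OF cong] frame_congruence_sym[OF cong uv]
        frame_congruence_refl[OF cong])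
  also have "inf (inf u v) w = inf u (inf v w)"
    by (rule inf_assoc)
  finally have "(inf u w, inf u (inf v w)) \<in> \<theta>" .
  moreover have "(inf u (inf v w), inf u v) \<in> \<theta>"
    by (rule frame_congruence_inf[OF cong frame_congruence_refl[OF cong] vw])
  ultimately have "(inf u w, inf u v) \<in> \<theta>"
    by (rule frame_congruence_trans[OF cong])
  from frame_congruence_trans[OF cong this uv] show ?thesis
    by (simp add: le_mod_def leq_relation_def)
qed

lemma le_mod_antisym:
  assumes "le_mod \<theta> u v" "le_mod \<theta> v u"
  shows "(u, v) \<in> \<theta>"
proof (rule frame_congruence_trans[OF cong])
  show "(u, inf u v) \<in> \<theta>" "(inf u v, v) \<in> \<theta>"
    using assms unfolding le_mod_def leq_relation_def inf_commute[of v u]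
    by (simp_all add: frame_congruence_sym[OF cong])
qed

lemma le_mod_cong:
  assumes "(u, v) \<in> \<theta>"
  shows "le_mod \<theta> u v"
proof -
  have "(inf u v, inf u u) \<in> \<theta>"
    by (intro frame_congruence_inf[OF cong] frame_congruence_refl[OF cong]
        frame_congruence_sym[OF cong assms])
  then show ?thesis
    by (simp add: le_mod_def leq_relation_def)
qed

lemma le_mod_cong': "(u, v) \<in> \<theta> \<Longrightarrow> le_mod \<theta> v u"
  by (rule le_mod_cong[OF frame_congruence_sym[OF cong]])

lemma le_mod_SUP_least:
  assumes "\<And>x. x \<in> A \<Longrightarrow> le_mod \<theta> (f x) v"
  shows "le_mod \<theta> (SUP x\<in>A. f x) v"
proof -
  have "(inf v (f x), f x) \<in> \<theta>" if "x \<in> A" for x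
    using assms[OF that] by (simp add: le_mod_def leq_relation_def inf_commute)
  then have "(SUP x\<in>A. inf v (f x), SUP x\<in>A. f x) \<in> \<theta>"
    by (rule frame_congruence_SUP[OF cong])
  then show ?thesis
    unfolding le_mod_def leq_relation_def
    by (simp add: inf_SUP_frame[symmetric] inf_commute)
qed

lemma le_mod_sup_least: "le_mod \<theta> u w \<Longrightarrow> le_mod \<theta> v w \<Longrightarrow> le_mod \<theta> (sup u v) w"
  using le_mod_SUP_least[of "{u, v}" "\<lambda>x. x" w] by auto

end

text \<open>The kernel of a frame homomorphism is a frame congruence, so \<open>E\<close> makes it
  contain the generated congruence, and \<open>inj\<close> gives the other inclusion. The classes
  are then exactly the fibres of \<open>h\<close>.\<close>

lemma presentation_isoI:
  fixes h :: "'g free_frame \<Rightarrow> 'a::frame"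
  assumes hom: "frame_hom h" and surj: "surj h"
    and E: "\<And>u v. (u, v) \<in> E \<Longrightarrow> h u = h v"
    and inj: "\<And>u v. h u = h v \<Longrightarrow> (u, v) \<in> generated_congruence E"
  shows "\<exists>\<phi> :: 'g free_frame set \<Rightarrow> 'a. presentation_iso E \<phi>"
proof -
  let ?\<theta> = "generated_congruence E"
  have "?\<theta> \<subseteq> {(u, v). h u = h v}"
    by (rule generated_congruence_least[OF frame_congruence_kernel[OF hom]]) (use E in blast)
  with inj have \<theta>: "?\<theta> = {(u, v). h u = h v}"
    by blast
  \<comment> \<open>The choice is harmless: \<open>h\<close> is constant on each class.\<close>
  define \<phi> where "\<phi> c = h (SOME u. u \<in> c)" for c
  have \<phi>: "\<phi> (?\<theta> `` {u}) = h u" for u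
    unfolding \<phi>_def \<theta> by (rule someI2[of _ u]) simp_all
  have "inj_on \<phi> (UNIV // ?\<theta>)"
  proof (rule inj_onI)
    fix a b assume "a \<in> UNIV // ?\<theta>" "b \<in> UNIV // ?\<theta>" and ab: "\<phi> a = \<phi> b"
    then obtain u v where uv: "a = ?\<theta> `` {u}" "b = ?\<theta> `` {v}"
      by (blast elim: quotientE)
    have "h u = h v"
      using ab unfolding uv \<phi> .
    then show "a = b"
      unfolding uv \<theta> by simp
  qed
  moreover have "\<phi> ` (UNIV // ?\<theta>) = UNIV"
  proof -
    have "x \<in> \<phi> ` (UNIV // ?\<theta>)" for x
    proof -
      obtain u where "x = h u"
        using surj by (rule surjE)
      then have "x = \<phi> (?\<theta> `` {u})"
        by (simp only: \<phi>)
      then show ?thesis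
        by (blast intro: quotientI)
    qed
    then show ?thesis
      by blast
  qed
  ultimately have "presentation_iso E \<phi>"
    unfolding presentation_iso_def bij_betw_def \<phi> using hom by blast
  then show ?thesis
    by (rule exI[of _ \<phi>])
qed

section \<open>The coverage theorem for DCPO-type presentations\<close>

locale dcpo_presentation =
  fixes R :: "('g::{distrib_lattice,bounded_lattice} set \<times> 'g set) set"
    and \<iota> :: "'g free_frame set \<Rightarrow> 'x::frame"
  assumes dcpo_type: "DCPO_type R"
    and iso: "presentation_iso (lattice_relations \<union> join_relations R) \<iota>"
begin

abbreviation "\<theta>X \<equiv> generated_congruence (lattice_relations \<union> join_relations R)"
abbreviation "\<gamma> \<equiv> generator_image R \<iota>"

definition proj :: "'g free_frame \<Rightarrow> 'x" where
  "proj u = \<iota> (\<theta>X `` {u})"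

lemma proj_hom: "frame_hom proj"
  using iso unfolding presentation_iso_def proj_def[abs_def] by blast

lemma proj_gen: "proj (gen g) = \<gamma> g"
  by (simp add: proj_def generator_image_def)

lemma surj_proj: "\<exists>u. x = proj u"
proof -
  have "\<iota> ` (UNIV // \<theta>X) = UNIV"
    using iso unfolding presentation_iso_def by (blast dest: bij_betw_imp_surj_on)
  then obtain c where "c \<in> UNIV // \<theta>X" "x = \<iota> c"
    by blast
  then show ?thesis
    unfolding proj_def by (blast elim: quotientE)
qed

lemma proj_eq_iff: "proj u = proj v \<longleftrightarrow> (u, v) \<in> \<theta>X"
proof -
  have inj: "inj_on \<iota> (UNIV // \<theta>X)"
    using iso unfolding presentation_iso_def by (blast dest: bij_betw_imp_inj_on)
  have "proj u = proj v \<longleftrightarrow> \<theta>X `` {u} = \<theta>X `` {v}"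
    unfolding proj_def using inj by (intro inj_on_eq_iff) (auto intro: quotientI)
  then show ?thesis
    by (simp add: eq_equiv_class_iff[OF frame_congruence_equiv[OF frame_congruence_generated]])
qed

lemma proj_relation: "(u, v) \<in> lattice_relations \<union> join_relations R \<Longrightarrow> proj u = proj v"
  unfolding proj_eq_iff by (rule subsetD[OF generated_congruence_base])

lemma \<gamma>_top: "\<gamma> top = top"
  using proj_relation[of "gen top" top]
  by (simp add: lattice_relations_def proj_gen frame_hom_top[OF proj_hom])

lemma \<gamma>_bot: "\<gamma> bot = bot"
  using proj_relation[of "gen bot" bot]
  by (simp add: lattice_relations_def proj_gen frame_hom_bot[OF proj_hom])

lemma \<gamma>_inf: "\<gamma> (inf s t) = inf (\<gamma> s) (\<gamma> t)"
proof -
  have "proj (gen (inf s t)) = proj (inf (gen s) (gen t))"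
    by (rule proj_relation) (auto simp: lattice_relations_def)
  then show ?thesis
    by (simp add: proj_gen frame_hom_inf[OF proj_hom])
qed

lemma \<gamma>_sup: "\<gamma> (sup s t) = sup (\<gamma> s) (\<gamma> t)"
proof -
  have "proj (gen (sup s t)) = proj (sup (gen s) (gen t))"
    by (rule proj_relation) (auto simp: lattice_relations_def)
  then show ?thesis
    by (simp add: proj_gen frame_hom_sup[OF proj_hom])
qed

lemma \<gamma>_mono: "s \<le> t \<Longrightarrow> \<gamma> s \<le> \<gamma> t"
  by (metis \<gamma>_inf inf.absorb_iff2 inf_commute)

lemma \<gamma>_join_relation:
  assumes "(A, B) \<in> R"
  shows "(SUP a\<in>A. \<gamma> a) \<le> (SUP b\<in>B. \<gamma> b)"
proof -
  let ?u = "SUP a\<in>A. gen a" and ?v = "SUP b\<in>B. gen b"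
  have "proj (inf ?u ?v) = proj ?u"
    using assms by (intro proj_relation) (auto simp: join_relations_def leq_relation_def)
  then have "proj ?u \<le> proj ?v"
    by (simp add: frame_hom_inf[OF proj_hom] inf.absorb_iff1)
  then show ?thesis
    by (simp add: frame_hom_Sup[OF proj_hom] image_image proj_gen)
qed

definition below :: "'x \<Rightarrow> 'g set" where
  "below x = {g. \<gamma> g \<le> x}"

lemma below_mono: "x \<le> y \<Longrightarrow> below x \<subseteq> below y"
  by (auto simp: below_def)

lemma directed_below: "directed (below x)"
  unfolding directed_def
proof (intro conjI ballI)
  show "below x \<noteq> {}"
    using \<gamma>_bot by (auto simp: below_def intro: exI[of _ bot])
  fix a b assume "a \<in> below x" "b \<in> below x"
  then show "\<exists>c\<in>below x. a \<le> c \<and> b \<le> c"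
    by (intro bexI[of _ "sup a b"]) (auto simp: below_def \<gamma>_sup)
qed

text \<open>The normal form in the free frame writes \<open>x\<close> as a join of finite meets of
  values of \<gamma>. Since \<gamma> preserves finite meets, each of these is itself the value of a
  single generator below \<open>x\<close>.\<close>

lemma SUP_below: "(SUP g\<in>below x. \<gamma> g) = x"
proof (rule antisym)
  show "(SUP g\<in>below x. \<gamma> g) \<le> x"
    by (auto simp: below_def intro: SUP_least)
  have meet: "\<exists>g. \<gamma> g = (INF a\<in>F. \<gamma> a)" if "finite F" for F
    using that
  proof (induction F rule: finite_induct)
    case empty
    then show ?case
      using \<gamma>_top by auto
  next
    case (insert a F)
    then show ?case
      by simp (metis \<gamma>_inf)
  qed
  obtain u where u: "x = proj u"
    using surj_proj by blast
  have "x = proj (SUP S\<in>Rep_free_frame u. INF g\<in>fset S. gen g)"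
    unfolding u using free_frame_normal_form[of u] by simp
  also have "\<dots> = (SUP S\<in>Rep_free_frame u. INF g\<in>fset S. \<gamma> g)"
    by (simp add: frame_hom_Sup[OF proj_hom] image_image
        frame_hom_finite_meet[OF proj_hom] proj_gen)
  finally have x: "x = (SUP S\<in>Rep_free_frame u. INF g\<in>fset S. \<gamma> g)" .
  show "x \<le> (SUP g\<in>below x. \<gamma> g)"
  proof (subst x, rule SUP_least)
    fix S assume S: "S \<in> Rep_free_frame u"
    obtain g where g: "\<gamma> g = (INF a\<in>fset S. \<gamma> a)"
      using meet[of "fset S"] by auto
    have "\<gamma> g \<le> x"
      unfolding g by (subst x) (use S in \<open>rule SUP_upper\<close>)
    then show "(INF a\<in>fset S. \<gamma> a) \<le> (SUP g\<in>below x. \<gamma> g)"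
      unfolding g[symmetric] by (intro SUP_upper) (simp add: below_def)
  qed
qed

text \<open>This is the canonical representation; the box relations are applied to it whenever an
  inequality modulo the congruence is derived from them.\<close>

lemma represents_below: "represents \<gamma> x (below x)"
  by (simp add: represents_def directed_below SUP_below)

section \<open>Closed down-sets of generators\<close>

definition closed_downset :: "'g set \<Rightarrow> bool" where
  "closed_downset J \<longleftrightarrow> (\<forall>x\<in>J. \<forall>y\<le>x. y \<in> J) \<and> (\<forall>(A, B)\<in>R. B \<subseteq> J \<longrightarrow> A \<subseteq> J)"

lemma closed_downset_lower: "closed_downset J \<Longrightarrow> x \<in> J \<Longrightarrow> y \<le> x \<Longrightarrow> y \<in> J"
  by (auto simp: closed_downset_def)

lemma closed_downset_relation:
  "closed_downset J \<Longrightarrow> (A, B) \<in> R \<Longrightarrow> B \<subseteq> J \<Longrightarrow> a \<in> A \<Longrightarrow> a \<in> J"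
  unfolding closed_downset_def by fast

lemma relation_inf: "(A, B) \<in> R \<Longrightarrow> ((\<lambda>a. inf a c) ` A, (\<lambda>b. inf b c) ` B) \<in> R"
  using dcpo_type unfolding DCPO_type_def by fast

lemma relation_sup: "(A, B) \<in> R \<Longrightarrow> ((\<lambda>a. sup a c) ` A, (\<lambda>b. sup b c) ` B) \<in> R"
  using dcpo_type unfolding DCPO_type_def by fast

lemma relation_directed: "(A, B) \<in> R \<Longrightarrow> directed A" "(A, B) \<in> R \<Longrightarrow> directed B"
  using dcpo_type unfolding DCPO_type_def by fast+

text \<open>Stability of \<open>R\<close> under joins with \<open>c\<close> is what makes this work.
  In \<open>coverage\<close> it shows that the closed down-set generated by a directed set is an
  ideal.\<close>

lemma closed_downset_sup_translate:
  assumes J: "closed_downset J"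
  shows "closed_downset {x. sup x c \<in> J}"
  unfolding closed_downset_def
proof (intro conjI ballI allI impI)
  fix x y assume "x \<in> {x. sup x c \<in> J}" "y \<le> x"
  then show "y \<in> {x. sup x c \<in> J}"
    by (auto intro: closed_downset_lower[OF J] sup_mono)
next
  fix r assume "r \<in> R"
  then show "case r of (A, B) \<Rightarrow> B \<subseteq> {x. sup x c \<in> J} \<longrightarrow> A \<subseteq> {x. sup x c \<in> J}"
    by (auto intro: closed_downset_relation[OF J relation_sup])
qed

text \<open>This is the frame homomorphism into the down-sets of the lattice that extends the
  principal down-set map, as the next lemmas confirm. It sees only the order and finite meets of the
  lattice, neither its joins nor \<open>R\<close>.\<close>

definition lower :: "'g free_frame \<Rightarrow> 'g set" where
  "lower u = {x. \<exists>S\<in>Rep_free_frame u. \<forall>g\<in>fset S. x \<le> g}"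

lemma lower_gen: "lower (gen g) = {..g}"
proof (intro equalityI subsetI)
  fix x assume "x \<in> {..g}"
  then show "x \<in> lower (gen g)"
    unfolding lower_def by (intro CollectI bexI[of _ "{|g|}"]) (auto simp: gen.rep_eq)
qed (auto simp: lower_def gen.rep_eq)

lemma lower_top: "lower top = UNIV"
  by (auto simp: lower_def top_free_frame.rep_eq intro: exI[of _ "{||}"])

lemma lower_Sup: "lower (Sup U) = (\<Union>u\<in>U. lower u)"
  by (auto simp: lower_def Sup_free_frame.rep_eq)

lemma lower_bot: "lower bot = {}"
  using lower_Sup[of "{}"] by simp

lemma lower_sup: "lower (sup u v) = lower u \<union> lower v"
  using lower_Sup[of "{u, v}"] by simp

lemma lower_inf: "lower (inf u v) = lower u \<inter> lower v"
proof (intro equalityI subsetI)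
  fix x assume "x \<in> lower u \<inter> lower v"
  then obtain S T where "S \<in> Rep_free_frame u" "\<forall>g\<in>fset S. x \<le> g"
      "T \<in> Rep_free_frame v" "\<forall>g\<in>fset T. x \<le> g"
    by (auto simp: lower_def)
  then show "x \<in> lower (inf u v)"
    using Rep_free_frame[of u] Rep_free_frame[of v] unfolding lower_def inf_free_frame.rep_eq
    by (intro CollectI bexI[of _ "S |\<union>| T"]) auto
qed (auto simp: lower_def inf_free_frame.rep_eq)

lemma lower_downset: "x \<in> lower u \<Longrightarrow> y \<le> x \<Longrightarrow> y \<in> lower u"
  unfolding lower_def by (blast intro: order_trans)

text \<open>
  One frame congruence for each closed ideal \<open>J\<close> takes the place of a frame of all closed ideals, in
  which the presentation would have to be interpreted.
\<close>

definition separating :: "'g set \<Rightarrow> ('g free_frame \<times> 'g free_frame) set" where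
  "separating J = {(u, v). \<forall>c. lower u \<inter> {..c} \<subseteq> J \<longleftrightarrow> lower v \<inter> {..c} \<subseteq> J}"

lemma frame_congruence_separating: "frame_congruence (separating J)"
  unfolding frame_congruence_def
proof (intro conjI allI impI)
  show "equiv UNIV (separating J)"
    by (auto simp: equiv_def refl_on_def sym_def trans_def separating_def)
next
  \<comment> \<open>Meeting with \<open>v\<close> amounts to testing \<open>u\<close> at the
    elements of \<open>lower v\<close> in place of \<open>c\<close>. The quantifier over all
    \<open>c\<close> in \<open>separating\<close> therefore makes the relation stable under
    meets.\<close>
  have swap: "lower (inf u v) \<inter> {..c} \<subseteq> J
      \<longleftrightarrow> (\<forall>x\<in>lower v \<inter> {..c}. lower u \<inter> {..x} \<subseteq> J)" for u v c
    unfolding lower_inf by (auto intro: lower_downset order_trans)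
  have left: "(inf a c, inf b c) \<in> separating J" if "(a, b) \<in> separating J" for a b c
    using that by (simp add: separating_def swap)
  fix a b c d assume *: "(a, b) \<in> separating J \<and> (c, d) \<in> separating J"
  have "(inf a c, inf b c) \<in> separating J" "(inf b c, inf b d) \<in> separating J"
    using * left[of a b c] left[of c d b] by (simp_all add: inf_commute)
  then show "(inf a c, inf b d) \<in> separating J"
    by (simp add: separating_def)
next
  fix P assume "P \<subseteq> separating J"
  then have "lower u \<inter> {..c} \<subseteq> J \<longleftrightarrow> lower v \<inter> {..c} \<subseteq> J" if "(u, v) \<in> P" for u v c
    using that by (auto simp: separating_def)
  then have "(\<forall>r\<in>P. lower (fst r) \<inter> {..c} \<subseteq> J) \<longleftrightarrow> (\<forall>r\<in>P. lower (snd r) \<inter> {..c} \<subseteq> J)" for c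
    by (intro ball_cong) auto
  moreover have "lower (Sup (f ` P)) \<inter> {..c} \<subseteq> J \<longleftrightarrow> (\<forall>r\<in>P. lower (f r) \<inter> {..c} \<subseteq> J)"
    for c and f :: "_ \<Rightarrow> 'g free_frame"
    unfolding lower_Sup by blast
  ultimately show "(Sup (fst ` P), Sup (snd ` P)) \<in> separating J"
    by (simp add: separating_def)
qed

text \<open>\<open>lower\<close> already respects top and binary meets. The relation for joins holds
  because distributivity splits any \<open>x\<close> below \<open>sup s t\<close> into
  \<open>inf x s\<close> and \<open>inf x t\<close>, whose join returns to the ideal
  \<open>J\<close>. The relation for bottom holds because \<open>lower (gen bot)\<close> is
  \<open>{bot}\<close> while \<open>lower bot\<close> is empty.\<close>

lemma lattice_relations_separating:
  assumes J: "closed_downset J" and bot: "bot \<in> J"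
    and sup: "\<And>x y. x \<in> J \<Longrightarrow> y \<in> J \<Longrightarrow> sup x y \<in> J"
  shows "lattice_relations \<subseteq> separating J"
proof -
  have "lower (gen (sup s t)) \<inter> {..c} \<subseteq> J"
    if "lower (sup (gen s) (gen t)) \<inter> {..c} \<subseteq> J" for s t c
  proof
    fix x assume x: "x \<in> lower (gen (sup s t)) \<inter> {..c}"
    then have "inf x s \<in> lower (sup (gen s) (gen t)) \<inter> {..c}"
        "inf x t \<in> lower (sup (gen s) (gen t)) \<inter> {..c}"
      by (auto simp: lower_gen lower_sup intro: le_infI1)
    with that have "sup (inf x s) (inf x t) \<in> J"
      by (intro sup) auto
    then show "x \<in> J"
      using x by (simp add: lower_gen inf_sup_distrib1[symmetric] inf.absorb1)
  qed
  moreover have "lower (sup (gen s) (gen t)) \<subseteq> lower (gen (sup s t))" for s t :: 'g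
    by (auto simp: lower_gen lower_sup intro: le_supI1 le_supI2)
  ultimately have "(gen (sup s t), sup (gen s) (gen t)) \<in> separating J" for s t
    unfolding separating_def by blast
  moreover have "(gen bot, bot) \<in> separating J"
    using bot by (auto simp: separating_def lower_gen lower_bot bot_unique)
  moreover have "(gen top, top) \<in> separating J"
    by (auto simp: separating_def lower_gen lower_top)
  moreover have "(gen (inf s t), inf (gen s) (gen t)) \<in> separating J" for s t
    by (auto simp: separating_def lower_gen lower_inf)
  ultimately show ?thesis
    by (auto simp: lattice_relations_def)
qed

text \<open>For \<open>x\<close> below some \<open>a\<close> in \<open>A\<close>, the relation met
  with \<open>x\<close> is again in \<open>R\<close>. Its right side lies in \<open>J\<close> by
  assumption, and its left side contains \<open>inf a x\<close>, which is \<open>x\<close>.\<close>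

lemma join_relations_separating:
  assumes J: "closed_downset J"
  shows "join_relations R \<subseteq> separating J"
proof -
  have "leq_relation (SUP a\<in>A. gen a) (SUP b\<in>B. gen b) \<in> separating J" if AB: "(A, B) \<in> R" for A B
  proof -
    let ?u = "SUP a\<in>A. gen a" and ?v = "SUP b\<in>B. gen b"
    have "lower ?u \<inter> {..c} \<subseteq> J" if *: "lower (inf ?u ?v) \<inter> {..c} \<subseteq> J" for c
    proof
      fix x assume "x \<in> lower ?u \<inter> {..c}"
      then obtain a where a: "a \<in> A" "x \<le> a" "x \<le> c"
        by (auto simp: lower_Sup lower_gen)
      have "inf b x \<in> J" if "b \<in> B" for b
      proof (rule subsetD[OF *])
        have "inf b x \<le> a" "inf b x \<le> b" "inf b x \<le> c"
          using a by (auto intro: le_infI2)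
        then show "inf b x \<in> lower (inf ?u ?v) \<inter> {..c}"
          using a(1) that unfolding lower_inf lower_Sup lower_gen image_image by blast
      qed
      then have "(\<lambda>b. inf b x) ` B \<subseteq> J"
        by blast
      then have "inf a x \<in> J"
        using a closed_downset_relation[OF J relation_inf[OF AB]] by auto
      then show "x \<in> J"
        using a by (simp add: inf.absorb2)
    qed
    then show ?thesis
      unfolding separating_def leq_relation_def by (auto simp: lower_inf)
  qed
  then show ?thesis
    by (auto simp: join_relations_def)
qed

text \<open>The generated closed down-set \<open>K\<close> is an ideal, so
  \<open>separating K\<close> is a congruence containing every defining relation, hence \<theta>X.
  The assumed inequality becomes a pair in \<theta>X and can be tested against
  \<open>K\<close>.\<close>

theorem coverage:
  assumes S: "directed S" and g: "\<gamma> g \<le> (SUP s\<in>S. \<gamma> s)"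
    and J: "closed_downset J" "S \<subseteq> J"
  shows "g \<in> J"
proof -
  \<comment> \<open>\<open>J\<close> itself need not be closed under binary joins; the least closed
    down-set over \<open>S\<close> is, because \<open>S\<close> is directed.\<close>
  define K where "K = \<Inter>{J. closed_downset J \<and> S \<subseteq> J}"
  have SK: "S \<subseteq> K"
    by (auto simp: K_def)
  have least: "K \<subseteq> J" if "closed_downset J" "S \<subseteq> J" for J
    using that by (auto simp: K_def)
  have K: "closed_downset K"
    unfolding closed_downset_def
  proof (intro conjI ballI allI impI)
    fix x y assume "x \<in> K" "y \<le> x"
    then show "y \<in> K"
      by (auto simp: K_def intro: closed_downset_lower)
  next
    have "a \<in> K" if AB: "(A, B) \<in> R" "B \<subseteq> K" "a \<in> A" for A B a
      unfolding K_def
    proof (intro InterI, elim CollectE conjE)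
      fix J assume "closed_downset J" "S \<subseteq> J"
      with least AB(2) show "a \<in> J"
        by (intro closed_downset_relation[OF _ AB(1) _ AB(3)]) blast+
    qed
    then show "case r of (A, B) \<Rightarrow> B \<subseteq> K \<longrightarrow> A \<subseteq> K" if "r \<in> R" for r
      using that by auto
  qed
  \<comment> \<open>Closure under joins takes two rounds of minimality: first with one argument in
    \<open>S\<close>, where directedness enters, then, by commutativity, with both arguments in
    \<open>K\<close>.\<close>
  have "K \<subseteq> {x. sup x c \<in> K}" if c: "c \<in> S" for c
  proof (rule least[OF closed_downset_sup_translate[OF K]], intro subsetI CollectI)
    fix x assume "x \<in> S"
    then obtain z where "z \<in> S" "x \<le> z" "c \<le> z"
      using S c by (auto simp: directed_def)
    then show "sup x c \<in> K"
      using SK by (auto intro: closed_downset_lower[OF K, of z])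
  qed
  then have "S \<subseteq> {x. sup x c \<in> K}" if "c \<in> K" for c
    using that by (auto simp: sup_commute)
  then have "K \<subseteq> {x. sup x c \<in> K}" if "c \<in> K" for c
    using that by (intro least[OF closed_downset_sup_translate[OF K]])
  then have sup: "sup x y \<in> K" if "x \<in> K" "y \<in> K" for x y
    using that by auto
  have bot: "bot \<in> K"
    using S SK by (auto simp: directed_def intro: closed_downset_lower[OF K])
  have "\<theta>X \<subseteq> separating K"
    using lattice_relations_separating[OF K bot sup] join_relations_separating[OF K]
    by (intro generated_congruence_least frame_congruence_separating) auto
  moreover have "proj (inf (gen g) (SUP s\<in>S. gen s)) = proj (gen g)"
    using g by (simp add: frame_hom_inf[OF proj_hom] frame_hom_Sup[OF proj_hom] image_image
        proj_gen inf.absorb1)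
  ultimately have "(inf (gen g) (SUP s\<in>S. gen s), gen g) \<in> separating K"
    by (auto simp: proj_eq_iff)
  moreover have "lower (inf (gen g) (SUP s\<in>S. gen s)) \<subseteq> K"
    using SK by (auto simp: lower_inf lower_Sup lower_gen intro: closed_downset_lower[OF K])
  \<comment> \<open>The instance \<open>c = top\<close> of \<open>separating\<close> imposes no
    restriction.\<close>
  ultimately have "lower (gen g) \<inter> {..top} \<subseteq> K"
    unfolding separating_def by blast
  then have "g \<in> K"
    by (auto simp: lower_gen)
  then show ?thesis
    using least[OF J] by blast
qed

end

section \<open>Semi-triquotients\<close>

locale semi_triquotient_presentation = dcpo_presentation R \<iota>
  for R :: "('g::{distrib_lattice,bounded_lattice} set \<times> 'g set) set"
    and \<iota> :: "'g free_frame set \<Rightarrow> 'x::frame" +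
  fixes qstar :: "'y::frame \<Rightarrow> 'x"
    and qsharp :: "'x \<Rightarrow> 'y"
  assumes semi_triquotient: "semi_triquotient qstar qsharp"
begin

definition k :: "'x \<Rightarrow> 'x" where
  "k = qstar \<circ> qsharp"

lemma k_apply: "k x = qstar (qsharp x)"
  by (simp add: k_def)

abbreviation "E \<equiv> join_relations R \<union> box_relations \<gamma> k"
abbreviation "\<theta> \<equiv> generated_congruence E"
abbreviation below_mod (infix "\<sqsubseteq>" 50) where "u \<sqsubseteq> v \<equiv> le_mod \<theta> u v"

lemma qstar_hom: "frame_hom qstar"
  using semi_triquotient by (simp add: semi_triquotient_def)

lemma qsharp_scott: "scott_continuous qsharp"
  using semi_triquotient by (simp add: semi_triquotient_def)

lemma qsharp_qstar: "qsharp (qstar y) = y"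
  using semi_triquotient by (simp add: semi_triquotient_def fun_eq_iff)

lemma qsharp_mono: "x \<le> y \<Longrightarrow> qsharp x \<le> qsharp y"
  by (rule scott_continuous_mono[OF qsharp_scott])

lemma k_mono: "x \<le> y \<Longrightarrow> k x \<le> k y"
  by (simp add: k_apply qsharp_mono frame_hom_mono[OF qstar_hom])

lemma qsharp_SUP:
  assumes "directed S"
  shows "qsharp (SUP s\<in>S. \<gamma> s) = (SUP s\<in>S. qsharp (\<gamma> s))"
  using scott_continuousD[OF qsharp_scott directed_image[OF assms \<gamma>_mono]]
  by (simp add: image_image)

lemma cong: "frame_congruence \<theta>"
  by (rule frame_congruence_generated)

lemmas le_mod_le = le_mod_le[OF cong]
  and le_mod_trans [trans] = le_mod_trans[OF cong]
  and le_mod_antisym = le_mod_antisym[OF cong]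
  and le_mod_cong = le_mod_cong[OF cong]
  and le_mod_cong' = le_mod_cong'[OF cong]
  and le_mod_SUP_least = le_mod_SUP_least[OF cong]
  and le_mod_sup_least = le_mod_sup_least[OF cong]

section \<open>The homomorphism from the free frame to the frame of \<open>Y\<close>\<close>

definition to_Y :: "'g free_frame \<Rightarrow> 'y" where
  "to_Y = (THE h. frame_hom h \<and> (\<forall>g. h (gen g) = qsharp (\<gamma> g)))"

lemma to_Y: "frame_hom to_Y" "to_Y (gen g) = qsharp (\<gamma> g)"
  using theI'[OF free_frame_universal[of "\<lambda>g. qsharp (\<gamma> g)"], folded to_Y_def] by simp_all

lemma SUP_\<gamma>_inf:
  assumes "represents \<gamma> x S" "represents \<gamma> y T"
  shows "(SUP a\<in>S. SUP b\<in>T. \<gamma> (inf a b)) = inf x y"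
  using assms by (simp add: represents_def SUP_inf_SUP_frame \<gamma>_inf)

lemma SUP_\<gamma>_sup:
  assumes "represents \<gamma> x S" "represents \<gamma> y T"
  shows "(SUP a\<in>S. SUP b\<in>T. \<gamma> (sup a b)) = sup x y"
proof -
  have ne: "S \<noteq> {}" "T \<noteq> {}"
    using assms by (auto simp: represents_def directed_def)
  have "(SUP a\<in>S. SUP b\<in>T. \<gamma> (sup a b)) = sup (SUP a\<in>S. \<gamma> a) (SUP b\<in>T. \<gamma> b)"
  proof (rule antisym)
    show "(SUP a\<in>S. SUP b\<in>T. \<gamma> (sup a b)) \<le> sup (SUP a\<in>S. \<gamma> a) (SUP b\<in>T. \<gamma> b)"
      unfolding \<gamma>_sup by (intro SUP_least sup_mono SUP_upper)
    show "sup (SUP a\<in>S. \<gamma> a) (SUP b\<in>T. \<gamma> b) \<le> (SUP a\<in>S. SUP b\<in>T. \<gamma> (sup a b))"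
    proof (intro le_supI SUP_least)
      \<comment> \<open>Directed sets are nonempty, so every element of one family has a partner in
        the other.\<close>
      obtain s t where st: "s \<in> S" "t \<in> T"
        using ne by blast
      show "\<gamma> a \<le> (SUP a\<in>S. SUP b\<in>T. \<gamma> (sup a b))" if "a \<in> S" for a
        using that st(2) by (intro SUP_upper2[of a S] SUP_upper2[of t T]) (simp_all add: \<gamma>_sup)
      show "\<gamma> b \<le> (SUP a\<in>S. SUP b\<in>T. \<gamma> (sup a b))" if "b \<in> T" for b
        using that st(1) by (intro SUP_upper2[of s S] SUP_upper2[of b T]) (simp_all add: \<gamma>_sup)
    qed
  qed
  then show ?thesis
    using assms by (simp add: represents_def)
qed

text \<open>\<open>qsharp\<close> is only known to preserve directed joins, so the double join is
  re-indexed by \<open>S \<times> T\<close>, whose image under the monotone \<open>f\<close> is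
  directed.\<close>

lemma qsharp_SUP2:
  assumes "directed S" "directed T"
    and mono: "\<And>a b c d. a \<le> c \<Longrightarrow> b \<le> d \<Longrightarrow> f a b \<le> f c d"
  shows "(SUP a\<in>S. SUP b\<in>T. qsharp (\<gamma> (f a b))) = qsharp (SUP a\<in>S. SUP b\<in>T. \<gamma> (f a b))"
  using qsharp_SUP[OF directed_image2[where f = f, OF assms]]
  by (simp add: image_image case_prod_beta SUP_prod[of "\<lambda>a b. \<gamma> (f a b)"]
      SUP_prod[of "\<lambda>a b. qsharp (\<gamma> (f a b))"])

text \<open>Relations of \<open>R\<close> survive because both sides are directed joins, which
  \<open>qsharp\<close> preserves. For the others, \<open>k\<close> takes values in the image of
  \<open>qstar\<close>, a subframe on which \<open>qsharp\<close> inverts \<open>qstar\<close> and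
  so preserves finite meets and joins.\<close>

lemma to_Y_relation:
  assumes "(u, v) \<in> E"
  shows "to_Y u = to_Y v"
proof -
  note hom = frame_hom_top[OF to_Y(1)] frame_hom_bot[OF to_Y(1)] frame_hom_inf[OF to_Y(1)]
    frame_hom_sup[OF to_Y(1)] frame_hom_Sup[OF to_Y(1)] image_image to_Y(2)
  consider (R) A B where "(A, B) \<in> R" "u = inf (SUP a\<in>A. gen a) (SUP b\<in>B. gen b)"
      "v = (SUP a\<in>A. gen a)"
    | (top) "u = gen top" "v = top"
    | (bot) "u = gen bot" "v = bot"
    | (inf) s t S T where "represents \<gamma> (k (\<gamma> s)) S" "represents \<gamma> (k (\<gamma> t)) T"
      "u = inf (gen s) (gen t)" "v = (SUP a\<in>S. SUP b\<in>T. gen (inf a b))"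
    | (sup) s t S T where "represents \<gamma> (k (\<gamma> s)) S" "represents \<gamma> (k (\<gamma> t)) T"
      "u = sup (gen s) (gen t)" "v = (SUP a\<in>S. SUP b\<in>T. gen (sup a b))"
    using assms unfolding join_relations_def box_relations_def leq_relation_def by blast
  then show ?thesis
  proof cases
    case R
    have "(SUP a\<in>A. qsharp (\<gamma> a)) \<le> (SUP b\<in>B. qsharp (\<gamma> b))"
      using qsharp_mono[OF \<gamma>_join_relation[OF R(1)]]
      by (simp add: qsharp_SUP[OF relation_directed(1)[OF R(1)]]
          qsharp_SUP[OF relation_directed(2)[OF R(1)]])
    then show ?thesis
      using R by (simp add: hom inf.absorb1)
  next
    case top
    then show ?thesis
      by (simp add: hom \<gamma>_top) (metis frame_hom_top qstar_hom qsharp_qstar)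
  next
    case bot
    then show ?thesis
      by (simp add: hom \<gamma>_bot) (metis frame_hom_bot qstar_hom qsharp_qstar)
  next
    case inf
    have "to_Y v = qsharp (inf (k (\<gamma> s)) (k (\<gamma> t)))"
      using inf(1,2) qsharp_SUP2[of S T inf, OF _ _ inf_mono]
      by (simp only: inf(4) hom represents_def SUP_\<gamma>_inf[OF inf(1,2)])
    then show ?thesis
      by (simp add: k_apply hom inf(3) frame_hom_inf[OF qstar_hom, symmetric] qsharp_qstar)
  next
    case sup
    have "to_Y v = qsharp (sup (k (\<gamma> s)) (k (\<gamma> t)))"
      using sup(1,2) qsharp_SUP2[of S T sup, OF _ _ sup_mono]
      by (simp only: sup(4) hom represents_def SUP_\<gamma>_sup[OF sup(1,2)])
    then show ?thesis
      by (simp add: k_apply hom sup(3) frame_hom_sup[OF qstar_hom, symmetric] qsharp_qstar)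
  qed
qed

section \<open>The candidate inverse and the coverage theorem for boxes\<close>

definition box :: "'y \<Rightarrow> 'g free_frame" where
  "box y = (SUP g\<in>below (qstar y). gen g)"

lemma box_mono: "y \<le> z \<Longrightarrow> box y \<le> box z"
  unfolding box_def by (intro SUP_subset_mono below_mono frame_hom_mono[OF qstar_hom]) auto

lemma box_upper: "\<gamma> g \<le> qstar y \<Longrightarrow> gen g \<le> box y"
  unfolding box_def by (rule SUP_upper) (simp add: below_def)

lemma to_Y_box: "to_Y (box y) = y"
  using qsharp_SUP[OF directed_below[of "qstar y"]]
  by (simp add: box_def frame_hom_Sup[OF to_Y(1)] image_image to_Y(2) SUP_below qsharp_qstar)

lemma relation_le_mod: "(u, v) \<in> E \<Longrightarrow> u \<sqsubseteq> v" "(u, v) \<in> E \<Longrightarrow> v \<sqsubseteq> u"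
  using generated_congruence_base[of E] by (blast intro: le_mod_cong le_mod_cong')+

lemma box_relation_inf:
  assumes "represents \<gamma> (k (\<gamma> s)) S" "represents \<gamma> (k (\<gamma> t)) T"
  shows "(inf (gen s) (gen t), SUP a\<in>S. SUP b\<in>T. gen (inf a b)) \<in> E"
  using assms unfolding box_relations_def by blast

lemma box_relation_sup:
  assumes "represents \<gamma> (k (\<gamma> s)) S" "represents \<gamma> (k (\<gamma> t)) T"
  shows "(sup (gen s) (gen t), SUP a\<in>S. SUP b\<in>T. gen (sup a b)) \<in> E"
  using assms unfolding box_relations_def by blast

lemma gen_inf_le_box: "inf (gen s) (gen t) \<sqsubseteq> box (inf (qsharp (\<gamma> s)) (qsharp (\<gamma> t)))"
proof -
  have "inf (gen s) (gen t)
      \<sqsubseteq> (SUP a\<in>below (k (\<gamma> s)). SUP b\<in>below (k (\<gamma> t)). gen (inf a b))"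
    by (intro relation_le_mod(1) box_relation_inf represents_below)
  also have "\<dots> \<sqsubseteq> box (inf (qsharp (\<gamma> s)) (qsharp (\<gamma> t)))"
    by (intro le_mod_le SUP_least box_upper)
      (auto simp: k_apply below_def \<gamma>_inf frame_hom_inf[OF qstar_hom] intro: le_infI1 le_infI2)
  finally show ?thesis .
qed

text \<open>On the diagonal the meet relation speaks of a single generator. With
  \<open>box_le_gen\<close> this identifies \<open>gen g\<close> with
  \<open>box (qsharp (\<gamma> g))\<close> modulo \<theta>.\<close>

lemma gen_le_box: "gen g \<sqsubseteq> box (qsharp (\<gamma> g))"
  using gen_inf_le_box[of g g] by simp

lemma box_le_gen: "box (qsharp (\<gamma> g)) \<sqsubseteq> gen g"
proof -
  have "box (qsharp (\<gamma> g))
      \<le> (SUP a\<in>below (k (\<gamma> g)). SUP b\<in>below (k (\<gamma> g)). gen (inf a b))"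
    unfolding box_def k_apply[symmetric]
  proof (rule SUP_least)
    fix a assume "a \<in> below (k (\<gamma> g))"
    then show "gen a \<le> (SUP a\<in>below (k (\<gamma> g)). SUP b\<in>below (k (\<gamma> g)). gen (inf a b))"
      \<comment> \<open>The diagonal term \<open>inf a a\<close> is used.\<close>
      by (intro SUP_upper2[of a] SUP_upper2[of a "below (k (\<gamma> g))"]) auto
  qed
  then have "box (qsharp (\<gamma> g))
      \<sqsubseteq> (SUP a\<in>below (k (\<gamma> g)). SUP b\<in>below (k (\<gamma> g)). gen (inf a b))"
    by (rule le_mod_le)
  also have "\<dots> \<sqsubseteq> inf (gen g) (gen g)"
    by (intro relation_le_mod(2) box_relation_inf represents_below)
  finally show ?thesis
    by simp
qed

text \<open>Monotonicity of the boxes is not imposed by \<open>box_relations\<close>; it is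
  inherited from \<gamma>, \<open>qsharp\<close> and \<open>box\<close> through the identification
  of \<open>gen g\<close> with \<open>box (qsharp (\<gamma> g))\<close>.\<close>

lemma gen_mono:
  assumes "s \<le> t"
  shows "gen s \<sqsubseteq> gen t"
proof -
  have "gen s \<sqsubseteq> box (qsharp (\<gamma> s))"
    by (rule gen_le_box)
  also have "\<dots> \<sqsubseteq> box (qsharp (\<gamma> t))"
    by (intro le_mod_le box_mono qsharp_mono \<gamma>_mono assms)
  also have "\<dots> \<sqsubseteq> gen t"
    by (rule box_le_gen)
  finally show ?thesis .
qed

text \<open>This lets \<open>coverage\<close>, a statement about the presentation of
  \<open>X\<close>, act modulo \<theta>. Such a set need not be an ideal, as \<open>qsharp\<close>
  need not preserve binary joins.\<close>

lemma closed_downset_gen: "closed_downset {g. gen g \<sqsubseteq> w}"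
  unfolding closed_downset_def
proof (intro conjI ballI allI impI)
  fix x y assume "x \<in> {g. gen g \<sqsubseteq> w}" "y \<le> x"
  then show "y \<in> {g. gen g \<sqsubseteq> w}"
    by (blast intro: le_mod_trans gen_mono)
next
  have "gen a \<sqsubseteq> w" if "(A, B) \<in> R" "B \<subseteq> {g. gen g \<sqsubseteq> w}" "a \<in> A" for A B a
  proof -
    have "gen a \<sqsubseteq> (SUP a\<in>A. gen a)"
      using that(3) by (intro le_mod_le SUP_upper)
    also have "leq_relation (SUP a\<in>A. gen a) (SUP b\<in>B. gen b) \<in> E"
      using that(1) unfolding join_relations_def by blast
    then have "(SUP a\<in>A. gen a) \<sqsubseteq> (SUP b\<in>B. gen b)"
      using generated_congruence_base[of E] unfolding le_mod_def by blast
    also have "\<dots> \<sqsubseteq> w"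
      using that(2) by (intro le_mod_SUP_least) auto
    finally show ?thesis .
  qed
  then show "case r of (A, B) \<Rightarrow> B \<subseteq> {g. gen g \<sqsubseteq> w} \<longrightarrow> A \<subseteq> {g. gen g \<sqsubseteq> w}"
    if "r \<in> R" for r
    using that by auto
qed

text \<open>Inequalities that hold in the frame of \<open>X\<close> by way of the lattice relations
  are not immediate for boxes, since \<open>E\<close> does not include those relations. Coverage
  transfers the ones with a directed join on the right.\<close>

lemma gen_coverage:
  assumes "directed S" "\<gamma> g \<le> (SUP s\<in>S. \<gamma> s)" "\<And>s. s \<in> S \<Longrightarrow> gen s \<sqsubseteq> w"
  shows "gen g \<sqsubseteq> w"
  using coverage[OF assms(1,2) closed_downset_gen[of w]] assms(3) by auto

section \<open>Finite meets and joins\<close>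

lemma box_top: "top \<sqsubseteq> box top"
proof -
  have "top \<sqsubseteq> gen top"
    by (rule relation_le_mod(2)) (simp add: box_relations_def)
  also have "\<dots> \<sqsubseteq> box top"
    by (intro le_mod_le box_upper) (simp add: frame_hom_top[OF qstar_hom])
  finally show ?thesis .
qed

lemma box_inf: "inf (box y) (box z) \<sqsubseteq> box (inf y z)"
proof -
  have "inf (gen s) (gen t) \<sqsubseteq> box (inf y z)" if "\<gamma> s \<le> qstar y" "\<gamma> t \<le> qstar z" for s t
  proof -
    have "inf (gen s) (gen t) \<sqsubseteq> box (inf (qsharp (\<gamma> s)) (qsharp (\<gamma> t)))"
      by (rule gen_inf_le_box)
    also have "\<dots> \<sqsubseteq> box (inf y z)"
      \<comment> \<open>Applying \<open>qsharp\<close> to \<open>\<gamma> s \<le> qstar y\<close>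
        gives \<open>qsharp (\<gamma> s) \<le> y\<close>, by the retraction law.\<close>
      using that[THEN qsharp_mono] by (intro le_mod_le box_mono inf_mono) (simp_all add: qsharp_qstar)
    finally show ?thesis .
  qed
  then show ?thesis
    unfolding box_def[of y] box_def[of z] SUP_inf_SUP_frame
    by (intro le_mod_SUP_least) (simp add: below_def)
qed

lemma box_bot: "box bot \<sqsubseteq> bot"
  unfolding box_def
proof (rule le_mod_SUP_least)
  fix g assume "g \<in> below (qstar bot)"
  \<comment> \<open>Generators other than \<open>bot\<close> may also be sent to \<open>bot\<close>
    by \<gamma>; coverage by the singleton \<open>{bot}\<close> handles them all.\<close>
  then have "\<gamma> g \<le> (SUP s\<in>{bot}. \<gamma> s)"
    by (simp add: below_def \<gamma>_bot frame_hom_bot[OF qstar_hom])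
  moreover have "directed {bot :: 'g}"
    by (simp add: directed_def)
  moreover have "gen bot \<sqsubseteq> bot"
    by (rule relation_le_mod(1)) (simp add: box_relations_def)
  ultimately show "gen g \<sqsubseteq> bot"
    using gen_coverage[of "{bot}" g bot] by simp
qed

text \<open>\<open>k\<close> preserves directed joins and fixes every
  \<open>qstar y\<close>.\<close>

lemma SUP_k_below: "(SUP s\<in>below (qstar y). k (\<gamma> s)) = qstar y"
proof -
  have "qstar (SUP s\<in>below (qstar y). qsharp (\<gamma> s)) = k (SUP s\<in>below (qstar y). \<gamma> s)"
    by (simp add: k_apply qsharp_SUP[OF directed_below])
  then show ?thesis
    by (simp add: frame_hom_Sup[OF qstar_hom] image_image SUP_below qsharp_qstar k_apply)
qed

text \<open>
  The join relation bounds \<open>\<boxtimes>(a \<or> b)\<close> only when \<open>a\<close> and \<open>b\<close> lie below elements \<open>k s\<close> and \<open>k t\<close>,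
  hence \<open>q\<^sup>* y\<close> is covered by the generators below the \<open>k s\<close> rather than by all \<open>s \<le> q\<^sup>* y\<close>.
\<close>

lemma box_sup: "box (sup y z) \<sqsubseteq> sup (box y) (box z)"
proof -
  define D where "D w = (\<Union>s\<in>below (qstar w). below (k (\<gamma> s)))" for w
  have D: "represents \<gamma> (qstar w) (D w)" for w
    unfolding represents_def
  proof
    show "qstar w = (SUP g\<in>D w. \<gamma> g)"
      by (simp only: D_def SUP_UNION SUP_below SUP_k_below)
    show "directed (D w)"
      unfolding directed_def
    proof (intro conjI ballI)
      obtain s where s: "s \<in> below (qstar w)"
        using directed_below[of "qstar w"] by (auto simp: directed_def)
      obtain a where a: "a \<in> below (k (\<gamma> s))"
        using directed_below[of "k (\<gamma> s)"] by (auto simp: directed_def)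
      show "D w \<noteq> {}"
        using s a unfolding D_def by blast
      fix a b assume "a \<in> D w" "b \<in> D w"
      then obtain s t where st: "s \<in> below (qstar w)" "a \<in> below (k (\<gamma> s))"
          "t \<in> below (qstar w)" "b \<in> below (k (\<gamma> t))"
        unfolding D_def by blast
      have "k (\<gamma> s) \<le> k (\<gamma> (sup s t))" "k (\<gamma> t) \<le> k (\<gamma> (sup s t))"
        by (intro k_mono \<gamma>_mono sup_ge1 sup_ge2)+
      with st have "sup a b \<in> below (k (\<gamma> (sup s t)))" "sup s t \<in> below (qstar w)"
        unfolding below_def mem_Collect_eq \<gamma>_sup[of a b] \<gamma>_sup[of s t]
        by (meson order_trans le_supI)+
      then show "\<exists>c\<in>D w. a \<le> c \<and> b \<le> c"
        unfolding D_def by (intro bexI[of _ "sup a b"]) auto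
    qed
  qed
  have gen: "gen (sup a b) \<sqsubseteq> sup (box y) (box z)" if ab: "a \<in> D y" "b \<in> D z" for a b
  proof -
    obtain s t where s: "s \<in> below (qstar y)" "a \<in> below (k (\<gamma> s))"
      and t: "t \<in> below (qstar z)" "b \<in> below (k (\<gamma> t))"
      using ab unfolding D_def by blast
    have "gen (sup a b) \<sqsubseteq> (SUP a\<in>below (k (\<gamma> s)). SUP b\<in>below (k (\<gamma> t)). gen (sup a b))"
      using s t by (intro le_mod_le SUP_upper2[of a] SUP_upper)
    also have "\<dots> \<sqsubseteq> sup (gen s) (gen t)"
      by (intro relation_le_mod(2) box_relation_sup represents_below)
    also have "\<dots> \<sqsubseteq> sup (box y) (box z)"
      using s t by (intro le_mod_le sup_mono box_upper) (auto simp: below_def)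
    finally show ?thesis .
  qed
  \<comment> \<open>The joins \<open>sup a b\<close> form a directed cover of
    \<open>qstar (sup y z)\<close>, so \<open>gen_coverage\<close> reduces the claim to the bound
    just proved.\<close>
  have dir: "directed (case_prod sup ` (D y \<times> D z))"
    using D[of y] D[of z] by (intro directed_image2 sup_mono) (simp_all add: represents_def)
  have cover: "(SUP g\<in>case_prod sup ` (D y \<times> D z). \<gamma> g) = sup (qstar y) (qstar z)"
    using SUP_\<gamma>_sup[OF D[of y] D[of z]]
    by (simp add: image_image case_prod_beta SUP_prod[of "\<lambda>a b. \<gamma> (sup a b)"])
  show ?thesis
    unfolding box_def[of "sup y z"]
  proof (rule le_mod_SUP_least)
    fix g assume "g \<in> below (qstar (sup y z))"
    then have "\<gamma> g \<le> (SUP g\<in>case_prod sup ` (D y \<times> D z). \<gamma> g)"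
      unfolding cover by (simp add: below_def frame_hom_sup[OF qstar_hom])
    then show "gen g \<sqsubseteq> sup (box y) (box z)"
      by (rule gen_coverage[OF dir]) (auto intro: gen)
  qed
qed

section \<open>Arbitrary joins and the isomorphism\<close>

lemma box_finite_Sup: "finite F \<Longrightarrow> box (Sup F) \<sqsubseteq> (SUP y\<in>F. box y)"
proof (induction F rule: finite_induct)
  case empty
  then show ?case
    by (simp only: Sup_empty image_empty box_bot)
next
  case (insert y F)
  have "box (Sup (insert y F)) \<sqsubseteq> sup (box y) (box (Sup F))"
    using box_sup by simp
  also have "\<dots> \<sqsubseteq> sup (box y) (SUP y\<in>F. box y)"
    using insert.IH by (intro le_mod_sup_least le_mod_le[OF sup_ge1])
      (rule le_mod_trans[OF _ le_mod_le[OF sup_ge2]])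
  finally show ?case
    by simp
qed

text \<open>An arbitrary join is the directed join of its finite subjoins. The generators below
  these form a directed cover of \<open>qstar (Sup Y)\<close>, so coverage reduces the claim to
  finite joins.\<close>

lemma box_Sup: "box (Sup Y) \<sqsubseteq> (SUP y\<in>Y. box y)"
proof -
  define D where "D = (\<Union>F\<in>{F. finite F \<and> F \<subseteq> Y}. below (qstar (Sup F)))"
  have "directed D"
    unfolding directed_def
  proof (intro conjI ballI)
    have "bot \<in> below (qstar (Sup {}))"
      by (simp add: below_def \<gamma>_bot)
    then show "D \<noteq> {}"
      unfolding D_def by blast
    fix a b assume "a \<in> D" "b \<in> D"
    then obtain F G where FG: "finite F" "F \<subseteq> Y" "finite G" "G \<subseteq> Y"
        "\<gamma> a \<le> qstar (Sup F)" "\<gamma> b \<le> qstar (Sup G)"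
      unfolding D_def below_def by blast
    then have "sup a b \<in> below (qstar (Sup (F \<union> G)))"
      unfolding below_def mem_Collect_eq \<gamma>_sup Sup_union_distrib frame_hom_sup[OF qstar_hom]
      by (intro sup_mono)
    then have "sup a b \<in> D"
      using FG unfolding D_def by blast
    then show "\<exists>c\<in>D. a \<le> c \<and> b \<le> c"
      by (intro bexI[of _ "sup a b"]) auto
  qed
  have cover: "qstar (Sup Y) \<le> (SUP g\<in>D. \<gamma> g)"
    unfolding frame_hom_Sup[OF qstar_hom]
  proof (rule SUP_least)
    fix y assume "y \<in> Y"
    then have "below (qstar y) \<subseteq> D"
      unfolding D_def by (intro UN_upper[of "{y}", where B = "\<lambda>F. below (qstar (Sup F))", simplified]) auto
    then have "(SUP g\<in>below (qstar y). \<gamma> g) \<le> (SUP g\<in>D. \<gamma> g)"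
      by (intro SUP_subset_mono) auto
    then show "qstar y \<le> (SUP g\<in>D. \<gamma> g)"
      by (simp add: SUP_below)
  qed
  have gen: "gen d \<sqsubseteq> (SUP y\<in>Y. box y)" if "d \<in> D" for d
  proof -
    obtain F where F: "finite F" "F \<subseteq> Y" "\<gamma> d \<le> qstar (Sup F)"
      using \<open>d \<in> D\<close> unfolding D_def below_def by blast
    have "gen d \<sqsubseteq> box (Sup F)"
      using F by (intro le_mod_le box_upper)
    also have "\<dots> \<sqsubseteq> (SUP y\<in>F. box y)"
      using F by (intro box_finite_Sup)
    also have "\<dots> \<sqsubseteq> (SUP y\<in>Y. box y)"
      using F by (intro le_mod_le SUP_subset_mono) auto
    finally show ?thesis .
  qed
  show ?thesis
    unfolding box_def[of "Sup Y"]
  proof (rule le_mod_SUP_least)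
    fix g assume "g \<in> below (qstar (Sup Y))"
    then have "\<gamma> g \<le> (SUP g\<in>D. \<gamma> g)"
      using cover by (auto simp: below_def)
    then show "gen g \<sqsubseteq> (SUP y\<in>Y. box y)"
      by (rule gen_coverage[OF \<open>directed D\<close> _ gen])
  qed
qed

text \<open>Modulo \<theta>, \<open>box\<close> preserves finite meets and all joins, and the claim
  holds on generators. The normal form carries it to every element of the free frame.\<close>

lemma box_to_Y: "(box (to_Y u), u) \<in> \<theta>"
proof -
  have inf: "(box (inf y z), inf (box y) (box z)) \<in> \<theta>" for y z
    by (intro le_mod_antisym box_inf le_mod_le) (simp add: box_mono)
  have Sup: "(box (Sup Y), SUP y\<in>Y. box y) \<in> \<theta>" for Y
    by (intro le_mod_antisym box_Sup le_mod_le SUP_least box_mono Sup_upper)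
  have meet: "(box (to_Y (INF g\<in>F. gen g)), INF g\<in>F. gen g) \<in> \<theta>" if "finite F" for F
    using that
  proof (induction F rule: finite_induct)
    case empty
    have "(box top, top) \<in> \<theta>"
      by (intro le_mod_antisym box_top le_mod_le top_greatest)
    then show ?case
      by (simp only: image_empty Inf_empty frame_hom_top[OF to_Y(1)])
  next
    case (insert g F)
    have "(box (to_Y (gen g)), gen g) \<in> \<theta>"
      by (simp add: to_Y(2) le_mod_antisym box_le_gen gen_le_box)
    from frame_congruence_inf[OF cong this insert.IH] inf[of "to_Y (gen g)" "to_Y (INF g\<in>F. gen g)"]
    show ?case
      by (simp add: frame_hom_inf[OF to_Y(1)]) (rule frame_congruence_trans[OF cong])
  qed
  let ?m = "\<lambda>S. INF g\<in>fset S. gen g"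
  let ?U = "Rep_free_frame u"
  have "(SUP S\<in>?U. box (to_Y (?m S)), SUP S\<in>?U. ?m S) \<in> \<theta>"
    by (intro frame_congruence_SUP[OF cong] meet) simp
  with Sup[of "(\<lambda>S. to_Y (?m S)) ` ?U"] have "(box (SUP S\<in>?U. to_Y (?m S)), SUP S\<in>?U. ?m S) \<in> \<theta>"
    unfolding image_image by (rule frame_congruence_trans[OF cong])
  then have "(box (to_Y (SUP S\<in>?U. ?m S)), SUP S\<in>?U. ?m S) \<in> \<theta>"
    by (simp add: frame_hom_Sup[OF to_Y(1)] image_image)
  then show ?thesis
    by (simp flip: free_frame_normal_form)
qed

text \<open>\<open>to_Y_box\<close> makes \<open>to_Y\<close> surjective. If
  \<open>to_Y u = to_Y v\<close>, then \<open>u\<close> and \<open>v\<close> are both congruent to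
  the same box.\<close>

lemma presents_Y: "\<exists>\<phi> :: 'g free_frame set \<Rightarrow> 'y. presentation_iso E \<phi>"
proof (rule presentation_isoI[OF to_Y(1)])
  show "surj to_Y"
    by (metis surjI to_Y_box)
  show "to_Y u = to_Y v" if "(u, v) \<in> E" for u v
    using that by (rule to_Y_relation)
  show "(u, v) \<in> \<theta>" if "to_Y u = to_Y v" for u v
    using box_to_Y[of u] box_to_Y[of v] that
    by (metis frame_congruence_sym[OF cong] frame_congruence_trans[OF cong])
qed

end

theorem proposition3p7:
  fixes R :: "('g::{distrib_lattice,bounded_lattice} set \<times> 'g set) set"
    and \<iota> :: "'g free_frame set \<Rightarrow> 'x::frame"
    and qstar :: "'y::frame \<Rightarrow> 'x"
    and qsharp :: "'x \<Rightarrow> 'y"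
  assumes "DCPO_type R"
    and "presentation_iso (lattice_relations \<union> join_relations R) \<iota>"
    and "semi_triquotient qstar qsharp"
  shows "\<exists>\<phi> :: 'g free_frame set \<Rightarrow> 'y.
    presentation_iso
      (join_relations R \<union> box_relations (generator_image R \<iota>) (qstar \<circ> qsharp)) \<phi>"
proof -
  interpret semi_triquotient_presentation R \<iota> qstar qsharp
    by unfold_locales (fact assms)+
  show ?thesis
    using presents_Y unfolding k_def .
qed

end
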